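(* For every $\varepsilon>0$ there is a positive constant $c_1(\varepsilon)$, depending only on $\varepsilon$, such that for any positive integers $n$ and $\ell$ (for which $u_\ell(n)$ is defined) $$u_{\ell}(n)\geq\begin{cases} c_1(\varepsilon)\,n^{\frac{1}{2}-\varepsilon}\,\ell&\text{for }\;\ell\leq n^{\frac{1}{2}-\varepsilon},\\ c_1(\varepsilon)\,\ell^2&\text{for }\; n^{\frac{1}{2}-\varepsilon}\leq\ell\leq n^{1-\varepsilon},\\ c_1(\varepsilon)\, n^{1-\varepsilon}\,\ell&\text{for }\; n^{1-\varepsilon}\leq\ell.\end{cases}$$
   Context: For integers $n>1$ and $\ell>1$, $u_{\ell}(n)$ denotes the minimum possible cardinality of a union of $n$ arithmetic progressions (of integers), each of length $\ell$, with pairwise distinct differences. An arithmetic progression of length $\ell$ with difference $b$ is a set $\{a+(j-1)b : j=1,\dots,\ell\}$. *)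

theory Defs
  imports Complex_Main
begin

definition arith_prog :: "int \<Rightarrow> int \<Rightarrow> nat \<Rightarrow> int set" where
  "arith_prog a b l = {a + (int j - 1) * b | j. j \<in> {1..l}}"

(* The difference b may be negative, but not 0, so that a progression of length l
   has l elements. *)
lemma card_arith_prog: "card (arith_prog a b l) = l" if "b \<noteq> 0"
proof -
  have "arith_prog a b l = (\<lambda>j. a + (int j - 1) * b) ` {1..l}"
    by (auto simp: arith_prog_def)
  moreover have "inj_on (\<lambda>j. a + (int j - 1) * b) {1..l}"
    using that by (auto simp: inj_on_def)
  ultimately show ?thesis
    by (simp add: card_image)
qed

definition ap_union_sizes :: "nat \<Rightarrow> nat \<Rightarrow> nat set" where
  "ap_union_sizes l n =
     {card (\<Union>i<n. arith_prog (a i) (b i) l) | a b :: nat \<Rightarrow> int.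
        inj_on b {..<n} \<and> (\<forall>i<n. b i \<noteq> 0)}"

definition u :: "nat \<Rightarrow> nat \<Rightarrow> nat" where
  "u l n = (LEAST m. m \<in> ap_union_sizes l n)"

lemma ap_union_sizes_nonempty: "ap_union_sizes l n \<noteq> {}"
proof -
  have "inj_on (\<lambda>i. int i + 1) {..<n} \<and> (\<forall>i<n. int i + 1 \<noteq> 0)"
    by (auto simp: inj_on_def)
  then show ?thesis
    unfolding ap_union_sizes_def by blast
qed

lemma u_attained: "u l n \<in> ap_union_sizes l n"
  unfolding u_def using ap_union_sizes_nonempty by (metis LeastI ex_in_conv)

lemma u_le: "m \<in> ap_union_sizes l n \<Longrightarrow> u l n \<le> m"
  unfolding u_def by (rule Least_le)

end

theory Submission
  imports Defs "HOL-Analysis.Convex" "HOL-Computational_Algebra.Primes"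
begin

text \<open>
  Everything rests on a bound for the multiplicative energy between a set \<open>B\<close> of \<open>N\<close> positive
  integers and \<open>{1..M}\<close>: the equation \<open>b p = b' q\<close> has at most \<open>O(N\<^bsup>1+\<epsilon>\<^esup> M\<^bsup>1+\<epsilon>\<^esup>)\<close> solutions.
  Iterated Cauchy--Schwarz reduces this to \<open>b p\<^sub>1 \<cdots> p\<^sub>t = b' q\<^sub>1 \<cdots> q\<^sub>t\<close> for \<open>t\<close> a large power of 2,
  where the divisor bound gives \<open>N\<^sup>2 M\<^bsup>t+o(1)\<^esup>\<close>, and the factor \<open>N\<^sup>2\<close> becomes \<open>N\<^bsup>1+1/t\<^esup>\<close> after
  taking \<open>t\<close>-th roots.

  For long progressions, two of them with differences \<open>b\<close> and \<open>b'\<close> share at most \<open>1 + l/h\<close>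
  elements, \<open>h\<close> being the height \<open>max b b' / gcd b b'\<close> of the ratio \<open>b/b'\<close>. The energy bound
  controls the number of pairs of small height, so the sum of all \<open>1/h\<close> is \<open>O(N\<^bsup>1+\<epsilon>\<^esup>)\<close>, and
  Cauchy--Schwarz gives \<open>(N l)\<^sup>2 \<le> u (N\<^sup>2 + O(l N\<^bsup>1+\<epsilon>\<^esup>))\<close>.

  For short progressions, the energy bound shows that for most pairs \<open>(b, j)\<close> with \<open>j \<le> l/2\<close> the
  product \<open>b j\<close> has only \<open>O(N\<^bsup>\<epsilon>\<^esup> l\<^bsup>\<epsilon>\<^esup>)\<close> representations of this form. Each progression
  contains about \<open>l\<^sup>2\<close> pairs of points at such distances, and each of the \<open>u\<^sup>2\<close> pairs of points of
  the union arises from few progressions, so \<open>N l\<^sup>2\<close> is at most about \<open>u\<^sup>2\<close>.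
\<close>

section \<open>The divisor bound\<close>

text \<open>A divisor of a product is a product of divisors of the factors, and \<open>p ^ k\<close>
  has \<open>k + 1\<close> of them.\<close>

lemma card_divisors_prime_power_mult:
  fixes m p k :: nat
  assumes "prime p" "0 < m"
  shows "card {d. d dvd p ^ k * m} \<le> (k + 1) * card {d. d dvd m}"
proof -
  have "{d. d dvd p ^ k * m} \<subseteq> (\<lambda>(i, d). p ^ i * d) ` ({..k} \<times> {d. d dvd m})"
  proof
    fix d assume "d \<in> {d. d dvd p ^ k * m}"
    then obtain a c where "d = a * c" "a dvd p ^ k" "c dvd m"
      by (auto elim: dvd_productE)
    with assms(1) show "d \<in> (\<lambda>(i, d). p ^ i * d) ` ({..k} \<times> {d. d dvd m})"
      by (auto simp: divides_primepow_nat)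
  qed
  then have "card {d. d dvd p ^ k * m} \<le> card ({..k} \<times> {d. d dvd m})"
    using assms(2) by (intro surj_card_le) (auto intro: finite_subset)
  then show ?thesis by (simp add: card_cartesian_product)
qed

text \<open>The divisor count and \<open>x powr \<eta>\<close> are both multiplicative, so they can
  be compared one prime power at a time. Primes with \<open>p powr \<eta> \<ge> 2\<close> lose
  nothing, since \<open>k + 1 \<le> 2 ^ k\<close>; each of the finitely many smaller primes costs a
  constant factor.\<close>

lemma card_divisors_le_powr:
  fixes \<eta> :: real
  assumes "0 < \<eta>"
  shows "\<exists>C\<ge>1. \<forall>x::nat. 0 < x \<longrightarrow> real (card {d. d dvd x}) \<le> C * real x powr \<eta>"
proof -
  \<comment> \<open>\<open>K \<ge> 1\<close> and \<open>K * \<eta> * ln 2 \<ge> 1\<close> give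
    \<open>k + 1 \<le> K * (1 + \<eta> * ln 2 * k)\<close>, while
    \<open>L powr \<eta> = 2\<close>.\<close>
  define K where "K = 1 + 1 / (\<eta> * ln 2)"
  define L where "L = 2 powr (1 / \<eta>)"
  define S where "S = {p::nat. real p < L}"
  have "finite S"
  proof -
    have "S \<subseteq> {..nat \<lceil>L\<rceil>}" by (auto simp: S_def) linarith
    then show ?thesis using finite_subset by blast
  qed
  have K: "1 \<le> K" using assms by (simp add: K_def)
  define g where "g x = K ^ card (prime_factors x \<inter> S)" for x :: nat
  have factor: "real (k + 1) \<le> (if p \<in> S then K else 1) * real (p ^ k) powr \<eta>"
    if "prime p" for p k :: nat
  proof (cases "p \<in> S")
    case True
    have "1 + \<eta> * ln 2 * k \<le> exp (\<eta> * ln 2 * k)" by (rule exp_ge_add_one_self)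
    also have "\<dots> = (2 ^ k) powr \<eta>" by (simp add: powr_def ln_realpow mult_ac)
    also have "\<dots> \<le> real (p ^ k) powr \<eta>"
      using prime_ge_2_nat[OF that] assms by (intro powr_mono2) (auto intro: power_mono)
    finally have *: "1 + \<eta> * ln 2 * k \<le> real (p ^ k) powr \<eta>" .
    have "real (k + 1) \<le> K * (1 + \<eta> * ln 2 * k)"
      using assms by (simp add: K_def field_simps)
    also have "\<dots> \<le> K * real (p ^ k) powr \<eta>" using * K by simp
    finally show ?thesis using True by simp
  next
    case False
    have "real (k + 1) \<le> 2 ^ k"
      by (metis Suc_eq_plus1 Suc_leI less_exp of_nat_le_iff of_nat_numeral of_nat_power)
    also have "\<dots> = (L ^ k) powr \<eta>"
      using assms by (simp add: L_def powr_power powr_powr flip: powr_realpow)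
    also have "\<dots> \<le> real (p ^ k) powr \<eta>"
      using False assms by (intro powr_mono2) (auto intro: power_mono simp: S_def L_def)
    finally show ?thesis using False by simp
  qed
  have g: "real (card {d. d dvd x}) \<le> g x * real x powr \<eta>" if "0 < x" for x :: nat
    using that
  proof (induction x rule: less_induct)
    case (less x)
    show ?case
    proof (cases "x = 1")
      case True then show ?thesis using K by (simp add: g_def)
    next
      case False
      then obtain p where p: "prime p" "p dvd x" using prime_factor_nat by blast
      \<comment> \<open>The full power of \<open>p\<close> is split off, so that \<open>p\<close>
        does not divide \<open>m\<close> and contributes its factor to \<open>g x\<close> exactly
        once.\<close>
      define k where "k = multiplicity p x"
      have "x \<noteq> 0" "\<not> is_unit p" using less.prems p(1) by auto
      then obtain m where m: "x = p ^ k * m" "\<not> p dvd m"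
        unfolding k_def by (rule multiplicity_decompose')
      have m0: "0 < m" using less.prems m by auto
      have k0: "0 < k" using p less.prems by (simp add: k_def prime_multiplicity_gt_zero_iff)
      have "1 < p ^ k" using prime_gt_1_nat[OF p(1)] k0 by (rule one_less_power)
      then have mx: "m < x" using m0 m(1) by simp
      have pf: "prime_factors x = insert p (prime_factors m)"
        using p(1) m0 k0 by (simp add: m(1) prime_factors_product prime_factorization_prime_power)
      have "p \<notin> prime_factors m" using m(2) by auto
      then have gx: "g x = (if p \<in> S then K else 1) * g m"
        using pf by (simp add: g_def)
      have "real (card {d. d dvd x}) \<le> real (k + 1) * real (card {d. d dvd m})"
        using card_divisors_prime_power_mult[OF p(1) m0, of k] m(1)
        by (metis of_nat_le_iff of_nat_mult)
      also have "\<dots> \<le> ((if p \<in> S then K else 1) * real (p ^ k) powr \<eta>) * (g m * real m powr \<eta>)"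
        using factor[OF p(1), of k] less.IH[OF mx m0] K by (intro mult_mono) auto
      also have "\<dots> = g x * real x powr \<eta>"
      proof -
        have "real x = real (p ^ k) * real m" by (simp add: m(1))
        then have "real x powr \<eta> = real (p ^ k) powr \<eta> * real m powr \<eta>"
          by (simp only: powr_mult of_nat_0_le_iff)
        then show ?thesis by (simp only: gx mult_ac)
      qed
      finally show ?thesis .
    qed
  qed
  show ?thesis
  proof (intro exI[of _ "K ^ card S"] conjI allI impI)
    show "1 \<le> K ^ card S" using K by (simp add: one_le_power)
    fix x :: nat assume "0 < x"
    have "g x \<le> K ^ card S"
      unfolding g_def using K \<open>finite S\<close> by (intro power_increasing card_mono) auto
    then have "g x * real x powr \<eta> \<le> K ^ card S * real x powr \<eta>"
      by (intro mult_right_mono) auto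
    with g[OF \<open>0 < x\<close>] show "real (card {d. d dvd x}) \<le> K ^ card S * real x powr \<eta>"
      by linarith
  qed
qed

section \<open>Multiplicative energy\<close>

text \<open>Ordered tuples, encoded as lists so that two of length \<open>t\<close> concatenate to
  one of length \<open>2 * t\<close> and can be separated again.\<close>

definition tuples :: "nat \<Rightarrow> nat \<Rightarrow> nat list set" where
  "tuples M t = {ps. set ps \<subseteq> {1..M} \<and> length ps = t}"

text \<open>For \<open>t = 1\<close> this is the multiplicative energy of \<open>B\<close> against
  \<open>{1..M}\<close>; larger \<open>t\<close> arise from Cauchy-Schwarz.\<close>

definition energy_solutions :: "nat set \<Rightarrow> nat \<Rightarrow> nat \<Rightarrow> (nat \<times> nat \<times> nat list \<times> nat list) set" where
  "energy_solutions B M t = {(b, b', ps, qs). b \<in> B \<and> b' \<in> B \<and> ps \<in> tuples M t \<and> qs \<in> tuples M t \<and>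
     b * prod_list ps = b' * prod_list qs}"

lemma finite_tuples [simp]: "finite (tuples M t)"
  by (simp add: tuples_def finite_lists_length_eq)

lemma card_tuples: "card (tuples M t) = M ^ t"
  by (simp add: tuples_def card_lists_length_eq)

lemma prod_list_tuples_pos: "ps \<in> tuples M t \<Longrightarrow> 0 < prod_list ps"
  by (fastforce simp: tuples_def prod_list_zero_iff intro!: Nat.gr0I)

lemma prod_list_tuples_le: "ps \<in> tuples M t \<Longrightarrow> prod_list ps \<le> M ^ t"
proof (induction ps arbitrary: t)
  case (Cons p ps)
  then have "p \<le> M" "ps \<in> tuples M (t - 1)" "t = Suc (t - 1)"
    by (auto simp: tuples_def)
  then have "p * prod_list ps \<le> M * M ^ (t - 1)"
    using Cons.IH by (intro mult_le_mono) auto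
  then show ?case using \<open>t = Suc (t - 1)\<close> by (metis power_Suc prod_list.Cons)
qed (auto simp: tuples_def)

lemma finite_energy_solutions [simp]: "finite B \<Longrightarrow> finite (energy_solutions B M t)"
  by (rule finite_subset[of _ "B \<times> B \<times> tuples M t \<times> tuples M t"]) (auto simp: energy_solutions_def)

text \<open>Cauchy-Schwarz over the first coordinate \<open>b\<close> leads to pairs of solutions
  with the same \<open>b\<close>. Eliminating \<open>b\<close> from such a pair yields a solution
  with tuples of double length.\<close>

lemma energy_power2_le:
  assumes "finite B"
  shows "(card (energy_solutions B M t))\<^sup>2 \<le> card B * card (energy_solutions B M (2 * t))"
proof -
  define F where "F b = {(b', ps, qs). b' \<in> B \<and> ps \<in> tuples M t \<and> qs \<in> tuples M t \<and>
     b * prod_list ps = b' * prod_list qs}" for b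
  have fin: "finite (F b)" for b
    using assms by (intro finite_subset[of "F b" "B \<times> tuples M t \<times> tuples M t"]) (auto simp: F_def)
  have "energy_solutions B M t = Sigma B F"
    by (auto simp: energy_solutions_def F_def)
  then have E: "card (energy_solutions B M t) = (\<Sum>b\<in>B. card (F b))"
    using assms fin by simp
  \<comment> \<open>Cross multiplication: both sides of the new equation equal \<open>b\<close>
    times the products of \<open>ps\<close> and \<open>ps'\<close>.\<close>
  let ?f = "\<lambda>(b :: nat, (b' :: nat, ps :: nat list, qs), (b'' :: nat, ps', qs')). (b', b'', qs @ ps', qs' @ ps)"
  have append: "ps @ qs \<in> tuples M (2 * t)" if "ps \<in> tuples M t" "qs \<in> tuples M t" for ps qs
    using that by (auto simp: tuples_def)
  have "?f ` (SIGMA b:B. F b \<times> F b) \<subseteq> energy_solutions B M (2 * t)"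
  proof (rule image_subsetI)
    fix z assume *: "z \<in> (SIGMA b:B. F b \<times> F b)"
    obtain b b1 ps1 qs1 b2 ps2 qs2 where z: "z = (b, (b1, ps1, qs1), (b2, ps2, qs2))"
      by (metis prod.exhaust)
    have t: "b1 \<in> B" "b2 \<in> B" "{ps1, qs1, ps2, qs2} \<subseteq> tuples M t"
      and eq: "b * prod_list ps1 = b1 * prod_list qs1" "b * prod_list ps2 = b2 * prod_list qs2"
      using * by (auto simp: z F_def)
    have "b1 * prod_list (qs1 @ ps2) = b * prod_list ps1 * prod_list ps2"
      by (simp add: eq(1))
    also have "\<dots> = b * prod_list ps2 * prod_list ps1" by simp
    also have "\<dots> = b2 * prod_list (qs2 @ ps1)" by (simp add: eq(2))
    finally show "?f z \<in> energy_solutions B M (2 * t)"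
      using t append by (simp add: z energy_solutions_def)
  qed
  \<comment> \<open>All tuples have length \<open>t\<close>, so the concatenations split uniquely;
    then \<open>b\<close> is recovered by cancelling the positive product of
    \<open>ps1\<close>.\<close>
  moreover have "inj_on ?f (SIGMA b:B. F b \<times> F b)"
  proof (rule inj_onI)
    fix z w assume zw: "z \<in> (SIGMA b:B. F b \<times> F b)" "w \<in> (SIGMA b:B. F b \<times> F b)" "?f z = ?f w"
    obtain b b1 ps1 qs1 b2 ps2 qs2 where z: "z = (b, (b1, ps1, qs1), (b2, ps2, qs2))"
      by (metis prod.exhaust)
    obtain c c1 rs1 ss1 c2 rs2 ss2 where w: "w = (c, (c1, rs1, ss1), (c2, rs2, ss2))"
      by (metis prod.exhaust)
    have t: "{ps1, qs1, ps2, qs2, rs1, ss1, rs2, ss2} \<subseteq> tuples M t"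
      and eq: "b * prod_list ps1 = b1 * prod_list qs1" "c * prod_list rs1 = c1 * prod_list ss1"
      using zw(1,2) by (auto simp: z w F_def)
    then have len: "length x = t" if "x \<in> {ps1, qs1, ps2, qs2, rs1, ss1, rs2, ss2}" for x
      using that by (auto simp: tuples_def)
    have same: "b1 = c1" "b2 = c2" "qs1 = ss1" "ps2 = rs2" "qs2 = ss2" "ps1 = rs1"
      using zw(3) len by (simp_all add: z w)
    have "0 < prod_list ps1" using t prod_list_tuples_pos by blast
    moreover have "b * prod_list ps1 = c * prod_list ps1" using eq same by simp
    ultimately have "b = c" by simp
    then show "z = w" by (simp add: z w same)
  qed
  ultimately have le: "card (SIGMA b:B. F b \<times> F b) \<le> card (energy_solutions B M (2 * t))"
    using assms by (intro card_inj_on_le) auto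
  have "(\<Sum>b\<in>B. real (card (F b)))\<^sup>2 \<le> (\<Sum>b\<in>B. (real (card (F b)))\<^sup>2) * real (card B)"
    by (rule sum_squared_le_sum_of_squares)
  then have "real ((card (energy_solutions B M t))\<^sup>2) \<le> real (card B * card (SIGMA b:B. F b \<times> F b))"
    using assms fin by (simp add: E card_cartesian_product power2_eq_square mult.commute)
  then have "(card (energy_solutions B M t))\<^sup>2 \<le> card B * card (SIGMA b:B. F b \<times> F b)"
    by (simp only: of_nat_le_iff)
  also have "\<dots> \<le> card B * card (energy_solutions B M (2 * t))"
    using le by (rule mult_le_mono2)
  finally show ?thesis .
qed

text \<open>Each squaring step turns an exponent \<open>e\<close> of \<open>card B\<close> into
  \<open>2 * e + 1\<close>, which from 0 produces \<open>2 ^ k - 1\<close>.\<close>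

lemma energy_power_le:
  assumes "finite B"
  shows "card (energy_solutions B M 1) ^ 2 ^ k \<le> card B ^ (2 ^ k - 1) * card (energy_solutions B M (2 ^ k))"
proof (induction k)
  case (Suc k)
  have "card (energy_solutions B M 1) ^ 2 ^ Suc k = (card (energy_solutions B M 1) ^ 2 ^ k)\<^sup>2"
    by (simp add: mult.commute flip: power_mult)
  also have "\<dots> \<le> (card B ^ (2 ^ k - 1) * card (energy_solutions B M (2 ^ k)))\<^sup>2"
    using Suc.IH by (intro power_mono) auto
  also have "\<dots> \<le> (card B ^ (2 ^ k - 1))\<^sup>2 * (card B * card (energy_solutions B M (2 ^ Suc k)))"
    using energy_power2_le[OF assms, of M "2 ^ k"] by (simp add: power_mult_distrib)
  also have "\<dots> = card B ^ (Suc ((2 ^ k - 1) * 2)) * card (energy_solutions B M (2 ^ Suc k))"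
    by (simp add: power2_eq_square mult_ac flip: power_mult power_add mult_2)
  also have "Suc ((2 ^ k - 1) * 2) = 2 ^ Suc k - 1"
  proof -
    have "(0::nat) < 2 ^ k" by simp
    then show ?thesis unfolding power_Suc by linarith
  qed
  finally show ?case .
qed simp

text \<open>Every entry of such a tuple divides \<open>x\<close>.\<close>

lemma card_tuples_with_product_le:
  assumes "0 < x"
  shows "card {ps \<in> tuples M t. prod_list ps = x} \<le> card {d. d dvd x} ^ t"
proof -
  have "{ps \<in> tuples M t. prod_list ps = x} \<subseteq> {ps. set ps \<subseteq> {d. d dvd x} \<and> length ps = t}"
    by (auto simp: tuples_def prod_list_dvd)
  moreover have "finite {d. d dvd x}" using assms by simp
  ultimately have "card {ps \<in> tuples M t. prod_list ps = x}
      \<le> card {ps. set ps \<subseteq> {d. d dvd x} \<and> length ps = t}"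
    by (intro card_mono finite_lists_length_eq)
  then show ?thesis using \<open>finite {d. d dvd x}\<close> by (simp only: card_lists_length_eq)
qed

text \<open>Once \<open>b\<close>, \<open>b'\<close> and \<open>qs\<close> are fixed, the product of
  \<open>ps\<close> is determined, and the divisor bound \<open>D\<close> leaves at most
  \<open>D ^ t\<close> choices for \<open>ps\<close>.\<close>

lemma energy_le:
  fixes D :: real
  assumes "finite B" "0 \<notin> B"
    and D: "\<And>x. 0 < x \<Longrightarrow> x \<le> M ^ t \<Longrightarrow> real (card {d. d dvd x}) \<le> D"
  shows "real (card (energy_solutions B M t)) \<le> (real (card B))\<^sup>2 * real M ^ t * D ^ t"
proof -
  define G where "G = (\<lambda>(b, b', qs). {ps \<in> tuples M t. b * prod_list ps = b' * prod_list qs})"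
  define I where "I = B \<times> B \<times> tuples M t"
  have I: "finite I" using assms(1) by (simp add: I_def)
  have finG: "finite (G i)" for i by (auto simp: G_def split: prod.splits)
  have G: "real (card (G i)) \<le> D ^ t" if iI: "i \<in> I" for i
  proof (cases "G i = {}")
    case True
    \<comment> \<open>The hypothesis at \<open>x = 1\<close> gives the sign of \<open>D\<close>. If
      \<open>M ^ t = 0\<close>, that point is out of range, but then there are no tuples and no
      \<open>i\<close>.\<close>
    have "0 \<le> D"
    proof (cases "M ^ t = 0")
      case False
      then show ?thesis using D[of 1] by (simp add: Suc_le_eq)
    next
      case True
      then have "tuples M t = {}" using card_tuples[of M t] by (metis card_0_eq finite_tuples)
      then show ?thesis using iI by (simp add: I_def)
    qed
    with True show ?thesis by simp
  next
    case False
    obtain b b' qs where i1: "i = (b, b', qs)" by (cases i)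
    with False obtain ps where i: "ps \<in> tuples M t" "b * prod_list ps = b' * prod_list qs" "b \<in> B"
      using iI by (auto simp: G_def I_def)
    define x where "x = prod_list ps"
    have x: "0 < x" "x \<le> M ^ t"
      using i(1) prod_list_tuples_pos prod_list_tuples_le by (auto simp: x_def)
    have "b \<noteq> 0" using i(3) assms(2) by metis
    then have "G i \<subseteq> {ps \<in> tuples M t. prod_list ps = x}"
      by (auto simp: G_def i1 x_def simp flip: i(2))
    then have "card (G i) \<le> card {ps \<in> tuples M t. prod_list ps = x}"
      by (intro card_mono) auto
    also have "\<dots> \<le> card {d. d dvd x} ^ t"
      by (rule card_tuples_with_product_le[OF x(1)])
    finally have "real (card (G i)) \<le> real (card {d. d dvd x}) ^ t"
      by (metis of_nat_le_iff of_nat_power)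
    also have "\<dots> \<le> D ^ t" using D[OF x] by (intro power_mono) auto
    finally show ?thesis .
  qed
  have "inj_on (\<lambda>(b, b', ps, qs). ((b, b', qs), ps)) (energy_solutions B M t)"
    by (auto simp: inj_on_def)
  then have "card (energy_solutions B M t) \<le> card (Sigma I G)"
    using I finG by (elim card_inj_on_le) (auto simp: energy_solutions_def I_def G_def)
  then have "real (card (energy_solutions B M t)) \<le> (\<Sum>i\<in>I. real (card (G i)))"
    using I finG by (simp add: flip: of_nat_sum)
  also have "\<dots> \<le> real (card I) * D ^ t"
    using G by (intro sum_bounded_above) auto
  finally show ?thesis
    by (simp add: I_def card_cartesian_product card_tuples power2_eq_square)
qed

section \<open>The energy bound for single factors\<close>

definition mult_quadruples :: "nat set \<Rightarrow> nat \<Rightarrow> (nat \<times> nat \<times> nat \<times> nat) set" where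
  "mult_quadruples B M = {(b, b', p, q). b \<in> B \<and> b' \<in> B \<and> p \<in> {1..M} \<and> q \<in> {1..M} \<and> b * p = b' * q}"

lemma finite_mult_quadruples [simp]: "finite B \<Longrightarrow> finite (mult_quadruples B M)"
  by (rule finite_subset[of _ "B \<times> B \<times> {1..M} \<times> {1..M}"]) (auto simp: mult_quadruples_def)

lemma card_mult_quadruples_le_energy:
  assumes "finite B"
  shows "card (mult_quadruples B M) \<le> card (energy_solutions B M 1)"
proof (rule card_inj_on_le)
  show "inj_on (\<lambda>(b, b', p, q). (b, b', [p], [q])) (mult_quadruples B M)"
    by (auto simp: inj_on_def)
  show "(\<lambda>(b, b', p, q). (b, b', [p], [q])) ` mult_quadruples B M \<subseteq> energy_solutions B M 1"
    by (auto simp: mult_quadruples_def energy_solutions_def tuples_def)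
qed (use assms in simp)

text \<open>The \<open>t\<close>-th power of the count is at most
  \<open>N ^ (t + 1) * (M * D) ^ t\<close>, where \<open>D\<close> is the divisor bound for numbers
  up to \<open>M ^ t\<close>. Taking \<open>t\<close>-th roots leaves only a small power of
  \<open>N\<close> beyond \<open>N * M * D\<close>.\<close>

lemma card_mult_quadruples_le:
  fixes \<epsilon> :: real
  assumes "0 < \<epsilon>"
  shows "\<exists>C\<ge>1. \<forall>B M. finite B \<longrightarrow> 0 \<notin> B \<longrightarrow>
    real (card (mult_quadruples B M)) \<le> C * real (card B) powr (1 + \<epsilon>) * real M powr (1 + \<epsilon>)"
proof -
  obtain k where k: "inverse \<epsilon> < 2 ^ k"
    using real_arch_pow[of 2] by auto
  \<comment> \<open>A power of 2, as the iteration requires, and with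
    \<open>\<epsilon> * t > 1\<close>, so that \<open>N ^ (t + 1)\<close> is at most the
    \<open>t\<close>-th power of \<open>N powr (1 + \<epsilon>)\<close>.\<close>
  define t :: nat where "t = 2 ^ k"
  have t: "0 < t" "1 / t \<le> \<epsilon>" "1 < \<epsilon> * t"
    using k assms by (auto simp: t_def field_simps)
  \<comment> \<open>With exponent \<open>\<epsilon> / t\<close>, the divisor bound at numbers up to
    \<open>M ^ t\<close> is only \<open>C * M powr \<epsilon>\<close>.\<close>
  obtain C where C: "1 \<le> C"
    and div: "\<And>x::nat. 0 < x \<Longrightarrow> real (card {d. d dvd x}) \<le> C * real x powr (\<epsilon> / t)"
    using card_divisors_le_powr[of "\<epsilon> / t"] assms t(1) by auto
  have "real (card (mult_quadruples B M)) \<le> C * real (card B) powr (1 + \<epsilon>) * real M powr (1 + \<epsilon>)"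
    if B: "finite B" "0 \<notin> B" for B M
  proof (cases "B = {} \<or> M = 0")
    case True
    then have "mult_quadruples B M = {}" by (auto simp: mult_quadruples_def)
    then show ?thesis using C by simp
  next
    case False
    define N where "N = card B"
    have N: "1 \<le> real N" and M: "1 \<le> real M"
      using False B by (auto simp: N_def Suc_le_eq card_gt_0_iff)
    define D where "D = C * real M powr \<epsilon>"
    have D: "real (card {d. d dvd x}) \<le> D" if "0 < x" "x \<le> M ^ t" for x
    proof -
      have "real x powr (\<epsilon> / t) \<le> (real M ^ t) powr (\<epsilon> / t)"
        using that assms by (intro powr_mono2) (auto simp flip: of_nat_power)
      also have "\<dots> = real M powr \<epsilon>"
        using M t(1) by (simp add: powr_powr flip: powr_realpow)
      finally have "C * real x powr (\<epsilon> / t) \<le> D"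
        unfolding D_def using C by (intro mult_left_mono) auto
      then show ?thesis using div[OF that(1)] by linarith
    qed
    have D0: "0 \<le> D" using C by (simp add: D_def)
    have "real (card (mult_quadruples B M)) ^ t \<le> real (card (energy_solutions B M 1)) ^ t"
      using card_mult_quadruples_le_energy[OF B(1), of M] by (intro power_mono) auto
    also have "\<dots> \<le> real (N ^ (t - 1) * card (energy_solutions B M t))"
      using energy_power_le[OF B(1), of M k] unfolding t_def N_def
      by (metis of_nat_le_iff of_nat_power)
    also have "\<dots> \<le> real N ^ (t - 1) * ((real N)\<^sup>2 * real M ^ t * D ^ t)"
      unfolding of_nat_mult of_nat_power
      using energy_le[OF B D] by (intro mult_left_mono) (auto simp: N_def)
    also have "\<dots> = real N ^ (t + 1) * (real M * D) ^ t"
    proof -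
      have "t + 1 = (t - 1) + 2" using t(1) by simp
      then show ?thesis by (simp only: power_add power_mult_distrib mult_ac)
    qed
    also have "\<dots> \<le> (real N powr (1 + \<epsilon>)) ^ t * (real M * D) ^ t"
    proof (intro mult_right_mono)
      have "real N ^ (t + 1) = real N powr (real t + 1)"
        using N by (simp add: powr_add powr_realpow)
      also have "\<dots> \<le> real N powr ((1 + \<epsilon>) * t)"
        using N t(3) by (intro powr_mono) (auto simp: algebra_simps)
      also have "\<dots> = (real N powr (1 + \<epsilon>)) ^ t"
        using N by (simp add: powr_powr flip: powr_realpow)
      finally show "real N ^ (t + 1) \<le> (real N powr (1 + \<epsilon>)) ^ t" .
    qed (use D0 in simp)
    also have "\<dots> = (real N powr (1 + \<epsilon>) * (real M * D)) ^ t"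
      by (simp add: power_mult_distrib)
    finally have "real (card (mult_quadruples B M)) \<le> real N powr (1 + \<epsilon>) * (real M * D)"
      using D0 t(1) by (simp add: power_mono_iff)
    also have "\<dots> = C * real N powr (1 + \<epsilon>) * real M powr (1 + \<epsilon>)"
      using M by (simp add: D_def powr_add)
    finally show ?thesis by (simp add: N_def)
  qed
  then show ?thesis using C by blast
qed

section \<open>Heights of ratios\<close>

text \<open>The sum telescopes to \<open>1 / h - 1 / N\<close> for \<open>h \<le> N\<close> and is
  empty otherwise. Summed over pairs, this is summation by parts: a sum of \<open>1 / h\<close>
  turns into counts of pairs with height at most \<open>m\<close>.\<close>

lemma inverse_le_sum:
  fixes h N :: nat
  assumes "0 < h" "0 < N"
  shows "1 / real h \<le> 1 / real N + (\<Sum>m\<in>{h..<N}. 1 / (real m * (real m + 1)))"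
proof (cases "h \<le> N")
  case True
  then have "(\<Sum>m\<in>{h..<N}. 1 / (real m * (real m + 1))) = 1 / h - 1 / N"
  proof (induction N rule: dec_induct)
    case (step m)
    then have "1 / (real m * (real m + 1)) = 1 / real m - 1 / real (Suc m)"
      using assms(1) by (simp add: field_simps)
    then show ?case using step by simp
  qed simp
  then show ?thesis by simp
next
  case False
  then show ?thesis using assms by (simp add: frac_le)
qed

lemma sum_inverse_le_ln: "0 < N \<Longrightarrow> (\<Sum>m\<in>{1..<N}. 1 / (real m + 1)) \<le> ln (real N)"
proof (induction N rule: nat_induct_non_zero)
  case (Suc N)
  have "ln (real N / (real N + 1)) \<le> real N / (real N + 1) - 1"
    using Suc.hyps by (intro ln_le_minus_one) auto
  then have "1 / (real N + 1) \<le> ln (real N + 1) - ln (real N)"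
    using Suc.hyps by (simp add: ln_div field_simps)
  then show ?case using Suc by (simp add: add.commute)
qed simp

text \<open>The larger of numerator and denominator of \<open>b / b'\<close> in lowest terms; for
  positive arguments, \<open>lcm b b'\<close> is the height times \<open>min b b'\<close>.\<close>

definition height :: "nat \<Rightarrow> nat \<Rightarrow> nat" where
  "height b b' = max b b' div gcd b b'"

text \<open>Pairs of height at most \<open>m\<close> inject into \<open>mult_quadruples B m\<close>.
  Summation by parts with this count leaves a harmonic sum, and cutting it off at
  \<open>N = card B\<close> costs \<open>1 / N\<close> for each of the \<open>N * N\<close>
  pairs.\<close>

lemma sum_inverse_height_le:
  fixes \<epsilon> :: real
  assumes "0 < \<epsilon>"
  shows "\<exists>C\<ge>1. \<forall>B. finite B \<longrightarrow> 0 \<notin> B \<longrightarrow>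
    (\<Sum>(b, b')\<in>B \<times> B. 1 / real (height b b')) \<le> C * real (card B) powr (1 + \<epsilon>)"
proof -
  \<comment> \<open>One \<open>\<delta>\<close> each for the energy bound in \<open>N\<close>, for
    \<open>m powr \<delta> \<le> N powr \<delta>\<close>, and for the logarithm from the harmonic
    sum.\<close>
  define \<delta> where "\<delta> = \<epsilon> / 3"
  have \<delta>: "0 < \<delta>" using assms by (simp add: \<delta>_def)
  obtain C where C: "1 \<le> C" and cross: "\<And>B M. finite B \<Longrightarrow> 0 \<notin> B \<Longrightarrow>
    real (card (mult_quadruples B M)) \<le> C * real (card B) powr (1 + \<delta>) * real M powr (1 + \<delta>)"
    using card_mult_quadruples_le[OF \<delta>] by auto
  define C' where "C' = 1 + C / \<delta>"
  have "(\<Sum>(b, b')\<in>B \<times> B. 1 / real (height b b')) \<le> C' * real (card B) powr (1 + \<epsilon>)"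
    if B: "finite B" "0 \<notin> B" for B
  proof (cases "B = {}")
    case False
    define N where "N = card B"
    have N: "1 \<le> real N" "0 < N"
      using False B by (auto simp: N_def Suc_le_eq card_gt_0_iff)
    have pos: "0 < b" if "b \<in> B" for b using that B(2) by (metis neq0_conv)
    have height_pos: "0 < height b b'" if "b \<in> B" "b' \<in> B" for b b'
      using pos[OF that(1)] pos[OF that(2)]
      by (auto simp: height_def div_greater_zero_iff max_def intro: dvd_imp_le)
    have level: "card {(b, b') \<in> B \<times> B. height b b' \<le> m} \<le> card (mult_quadruples B m)" for m
    proof -
      \<comment> \<open>The reduced numerator and denominator, crosswise, solve
        \<open>b * p = b' * q\<close> and are bounded by the height.\<close>
      let ?f = "\<lambda>(b, b'). (b, b', b' div gcd b b', b div gcd b b')"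
      have "?f (b, b') \<in> mult_quadruples B m" if "b \<in> B" "b' \<in> B" "height b b' \<le> m" for b b'
      proof -
        have "b' div gcd b b' \<le> height b b'" "b div gcd b b' \<le> height b b'"
          by (auto simp: height_def div_le_mono)
        moreover have "0 < b' div gcd b b'" "0 < b div gcd b b'"
          using pos[OF that(1)] pos[OF that(2)] by (auto simp: div_greater_zero_iff intro: dvd_imp_le)
        moreover have "b * (b' div gcd b b') = b' * (b div gcd b b')"
          by (metis div_mult_swap gcd_dvd1 gcd_dvd2 mult.commute)
        ultimately show ?thesis using that by (auto simp: mult_quadruples_def)
      qed
      then show ?thesis using B(1) by (intro card_inj_on_le[of ?f]) (auto simp: inj_on_def)
    qed
    have "(\<Sum>(b, b')\<in>B \<times> B. 1 / real (height b b'))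
        \<le> (\<Sum>(b, b')\<in>B \<times> B. 1 / real N + (\<Sum>m\<in>{1..<N}.
              if height b b' \<le> m then 1 / (real m * (real m + 1)) else 0))"
    proof (intro sum_mono, clarify)
      fix b b' assume "b \<in> B" "b' \<in> B"
      let ?h = "height b b'"
      note h = height_pos[OF \<open>b \<in> B\<close> \<open>b' \<in> B\<close>]
      have "(\<Sum>m\<in>{?h..<N}. 1 / (real m * (real m + 1)))
          = (\<Sum>m\<in>{1..<N}. if ?h \<le> m then 1 / (real m * (real m + 1)) else 0)"
        using h by (intro sum.mono_neutral_cong_left) auto
      then show "1 / real ?h \<le> 1 / real N + (\<Sum>m\<in>{1..<N}.
              if ?h \<le> m then 1 / (real m * (real m + 1)) else 0)"
        using inverse_le_sum[OF h N(2)] by simp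
    qed
    also have "\<dots> = real N + (\<Sum>m\<in>{1..<N}.
        real (card {(b, b') \<in> B \<times> B. height b b' \<le> m}) / (real m * (real m + 1)))"
    proof -
      have "(\<Sum>(b, b')\<in>B \<times> B. 1 / real N) = real N"
        using N by (simp add: N_def card_cartesian_product)
      moreover have "(\<Sum>(b, b')\<in>B \<times> B. if height b b' \<le> m then 1 / (real m * (real m + 1)) else 0)
          = real (card {(b, b') \<in> B \<times> B. height b b' \<le> m}) / (real m * (real m + 1))" for m
      proof -
        have "(\<Sum>z\<in>B \<times> B. if height (fst z) (snd z) \<le> m then 1 / (real m * (real m + 1)) else 0)
          = (\<Sum>z\<in>{z \<in> B \<times> B. height (fst z) (snd z) \<le> m}. 1 / (real m * (real m + 1)))"
          using B(1) by (intro sum.inter_filter[symmetric]) auto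
        moreover have "{z \<in> B \<times> B. height (fst z) (snd z) \<le> m} = {(b, b') \<in> B \<times> B. height b b' \<le> m}"
          by auto
        ultimately show ?thesis by (simp add: case_prod_unfold)
      qed
      ultimately show ?thesis
        by (simp add: case_prod_unfold sum.distrib)
           (subst sum.swap, simp add: case_prod_unfold)
    qed
    also have "\<dots> \<le> real N + (\<Sum>m\<in>{1..<N}. C * real N powr (1 + 2 * \<delta>) * (1 / (real m + 1)))"
    proof (intro add_left_mono sum_mono)
      fix m assume m: "m \<in> {1..<N}"
      have "real (card {(b, b') \<in> B \<times> B. height b b' \<le> m})
          \<le> C * real N powr (1 + \<delta>) * real m powr (1 + \<delta>)"
        using level[of m] cross[OF B, of m] by (simp add: N_def)
      also have "\<dots> = C * real N powr (1 + \<delta>) * real m powr \<delta> * real m"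
        using m by (simp add: powr_add)
      also have "\<dots> \<le> C * real N powr (1 + \<delta>) * real N powr \<delta> * real m"
        using m C \<delta> by (intro mult_right_mono mult_left_mono powr_mono2) auto
      also have "\<dots> = C * real N powr (1 + 2 * \<delta>) * real m"
        using N by (simp add: add.commute flip: powr_add)
      finally have "real (card {(b, b') \<in> B \<times> B. height b b' \<le> m}) / (real m * (real m + 1))
          \<le> C * real N powr (1 + 2 * \<delta>) * real m / (real m * (real m + 1))"
        by (rule divide_right_mono) simp
      also have "\<dots> = C * real N powr (1 + 2 * \<delta>) * (1 / (real m + 1))"
        using m by simp
      finally show "real (card {(b, b') \<in> B \<times> B. height b b' \<le> m}) / (real m * (real m + 1))
          \<le> C * real N powr (1 + 2 * \<delta>) * (1 / (real m + 1))" .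
    qed
    also have "\<dots> = real N + C * real N powr (1 + 2 * \<delta>) * (\<Sum>m\<in>{1..<N}. 1 / (real m + 1))"
      by (simp only: sum_distrib_left)
    also have "\<dots> \<le> real N powr (1 + 3 * \<delta>) + C * real N powr (1 + 2 * \<delta>) * (real N powr \<delta> / \<delta>)"
    proof (intro add_mono mult_left_mono)
      show "real N \<le> real N powr (1 + 3 * \<delta>)"
        using N \<delta> powr_mono[of 1 "1 + 3 * \<delta>" "real N"] by simp
      show "(\<Sum>m\<in>{1..<N}. 1 / (real m + 1)) \<le> real N powr \<delta> / \<delta>"
        using sum_inverse_le_ln[OF N(2)] ln_powr_bound[OF N(1) \<delta>] by linarith
    qed (use C in simp)
    also have "\<dots> = C' * real N powr (1 + \<epsilon>)"
    proof -
      have "real N powr (1 + 2 * \<delta>) * real N powr \<delta> = real N powr (1 + \<epsilon>)" "1 + 3 * \<delta> = 1 + \<epsilon>"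
        by (simp_all add: \<delta>_def add.commute flip: powr_add)
      then show ?thesis by (simp add: C'_def algebra_simps)
    qed
    finally show ?thesis by (simp add: N_def)
  qed simp
  moreover have "1 \<le> C'" using C \<delta> by (simp add: C'_def)
  ultimately show ?thesis by blast
qed

section \<open>Unions of arithmetic progressions\<close>

lemma arith_prog_conv_image: "arith_prog a b l = (\<lambda>j. a + int j * b) ` {..<l}"
proof -
  have "{1..l} = Suc ` {..<l}"
    by (simp add: lessThan_atLeast0 image_Suc_atLeastLessThan atLeastLessThanSuc_atLeastAtMost)
  moreover have "arith_prog a b l = (\<lambda>j. a + (int j - 1) * b) ` {1..l}"
    by (auto simp: arith_prog_def)
  ultimately show ?thesis by (simp only: image_image) simp
qed

text \<open>Reading a progression backwards from its last term flips the sign of its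
  difference.\<close>

lemma arith_prog_uminus_subset: "arith_prog (a + (int l - 1) * b) (- b) l \<subseteq> arith_prog a b l"
proof
  fix x assume "x \<in> arith_prog (a + (int l - 1) * b) (- b) l"
  then obtain j where "j < l" "x = a + (int l - 1) * b + int j * (- b)"
    by (auto simp: arith_prog_conv_image)
  then have "x = a + int (l - 1 - j) * b" "l - 1 - j < l"
    by (auto simp: of_nat_diff algebra_simps)
  then show "x \<in> arith_prog a b l" by (auto simp: arith_prog_conv_image)
qed

lemma height_commute: "height b b' = height b' b"
  by (simp add: height_def max.commute gcd.commute)

text \<open>In the progression with the smaller difference, the indices of common points are all
  congruent modulo the height \<open>h\<close>, so there are at most \<open>l div h + 1\<close> of
  them.\<close>

lemma card_inter_arith_prog_le:
  fixes b b' :: nat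
  assumes "0 < b" "0 < b'"
  shows "real (card (arith_prog a (int b) l \<inter> arith_prog a' (int b') l))
    \<le> 1 + real l / real (height b b')"
  using assms
proof (induction b b' arbitrary: a a' rule: linorder_wlog)
  case (sym b b')
  then show ?case by (simp add: height_commute Int_commute)
next
  case (le b' b)
  define h where "h = height b' b"
  define g where "g = gcd b' b"
  have g: "0 < g" using le.prems by (simp add: g_def)
  \<comment> \<open>Here \<open>b' \<le> b\<close>, so the reduced form of the larger difference is
    \<open>h\<close>.\<close>
  have b: "b = h * g"
    using le.hyps by (simp add: h_def height_def g_def)
  obtain c where b': "b' = c * g" unfolding g_def by (metis dvdE gcd_dvd1 mult.commute)
  have "coprime h c"
  proof -
    have "g * gcd h c = g"
      by (metis b b' g_def gcd.commute gcd_mult_distrib_nat mult.commute)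
    then show ?thesis using g by (simp add: coprime_iff_gcd_eq_1)
  qed
  have h: "0 < h" using b le.prems by (metis gr0I mult_0)
  define J where "J = {j. j < l \<and> a + int j * int b' \<in> arith_prog a' (int b) l}"
  have "J \<subseteq> {..<l}" by (auto simp: J_def)
  then have J: "finite J" by (rule finite_subset) simp
  have mod: "j mod h = k mod h" if jk: "j \<in> J" "k \<in> J" for j k
  proof -
    obtain x y :: nat where "a + int j * int b' = a' + int x * int b" "a + int k * int b' = a' + int y * int b"
      using jk by (auto simp: J_def arith_prog_conv_image)
    \<comment> \<open>Subtraction removes both starting points; after dividing by \<open>g\<close>,
      coprimality of \<open>h\<close> and \<open>c\<close> forces \<open>h\<close> to divide
      \<open>j - k\<close>.\<close>
    then have "(int j - int k) * int b' = (int x - int y) * int b"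
      by (simp add: left_diff_distrib)
    then have "((int j - int k) * int c) * int g = ((int x - int y) * int h) * int g"
      by (simp add: b b' mult.assoc)
    then have "(int j - int k) * int c = (int x - int y) * int h"
      using g by simp
    then have "int h dvd (int j - int k) * int c" by simp
    moreover have "coprime (int h) (int c)" using \<open>coprime h c\<close> by simp
    ultimately have "int h dvd int j - int k" by (simp add: coprime_dvd_mult_left_iff)
    then have "int j mod int h = int k mod int h" by (simp add: mod_eq_dvd_iff)
    then show ?thesis by (simp flip: of_nat_mod)
  qed
  have "inj_on (\<lambda>j. j div h) J"
    using mod by (intro inj_onI) (metis div_mod_decomp)
  moreover have "(\<lambda>j. j div h) ` J \<subseteq> {..l div h}"
    by (auto simp: J_def div_le_mono)
  ultimately have "card J \<le> Suc (l div h)"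
    using card_inj_on_le[of "\<lambda>j. j div h" J "{..l div h}"] by simp
  moreover have "arith_prog a (int b') l \<inter> arith_prog a' (int b) l \<subseteq> (\<lambda>j. a + int j * int b') ` J"
    by (auto simp: J_def arith_prog_conv_image)
  then have "card (arith_prog a (int b') l \<inter> arith_prog a' (int b) l) \<le> card J"
    using J by (rule surj_card_le[rotated])
  ultimately have "real (card (arith_prog a (int b') l \<inter> arith_prog a' (int b) l)) \<le> 1 + real (l div h)"
    by linarith
  then show ?case using of_nat_div_le_of_nat[of l h, where ?'a = real] by (simp add: h_def)
qed

section \<open>Double counts of points and of pairs of points\<close>

text \<open>Cauchy-Schwarz over the points \<open>x\<close> of the union, applied to the number of
  sets \<open>S b\<close> containing \<open>x\<close>; expanding its square counts pairs of
  sets.\<close>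

lemma sum_card_power2_le:
  assumes "finite B" "\<And>b. b \<in> B \<Longrightarrow> finite (S b)"
  shows "(\<Sum>b\<in>B. real (card (S b)))\<^sup>2
    \<le> real (card (\<Union>b\<in>B. S b)) * (\<Sum>(b, b')\<in>B \<times> B. real (card (S b \<inter> S b')))"
proof -
  define A where "A = (\<Union>b\<in>B. S b)"
  define ind where "ind b x = (of_bool (x \<in> S b) :: real)" for b x
  have A: "finite A" using assms by (simp add: A_def)
  have card: "real (card T) = (\<Sum>x\<in>A. of_bool (x \<in> T))" if "T \<subseteq> A" for T
    using that A by (simp add: Int_absorb1 Int_commute)
  have "(\<Sum>b\<in>B. real (card (S b))) = (\<Sum>b\<in>B. \<Sum>x\<in>A. ind b x)"
    unfolding ind_def by (intro sum.cong refl card) (auto simp: A_def)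
  also have "\<dots> = (\<Sum>x\<in>A. \<Sum>b\<in>B. ind b x)" by (rule sum.swap)
  finally have "(\<Sum>b\<in>B. real (card (S b)))\<^sup>2 \<le> (\<Sum>x\<in>A. (\<Sum>b\<in>B. ind b x)\<^sup>2) * real (card A)"
    using sum_squared_le_sum_of_squares[of "\<lambda>x. \<Sum>b\<in>B. ind b x" A] by simp
  also have "(\<Sum>x\<in>A. (\<Sum>b\<in>B. ind b x)\<^sup>2) = (\<Sum>x\<in>A. \<Sum>(b, b')\<in>B \<times> B. ind b x * ind b' x)"
    by (simp add: power2_eq_square sum_product sum.cartesian_product)
  also have "\<dots> = (\<Sum>(b, b')\<in>B \<times> B. \<Sum>x\<in>A. ind b x * ind b' x)"
    by (simp add: case_prod_unfold sum.swap[of _ A])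
  also have "\<dots> = (\<Sum>(b, b')\<in>B \<times> B. real (card (S b \<inter> S b')))"
  proof (intro sum.cong refl, clarify)
    fix b b' assume "b \<in> B"
    then have "real (card (S b \<inter> S b')) = (\<Sum>x\<in>A. of_bool (x \<in> S b \<inter> S b'))"
      by (intro card) (auto simp: A_def)
    then show "(\<Sum>x\<in>A. ind b x * ind b' x) = real (card (S b \<inter> S b'))"
      by (simp add: ind_def flip: of_bool_conj)
  qed
  finally show ?thesis by (simp add: A_def mult.commute)
qed

text \<open>Each \<open>(b, j, k)\<close> gives two points of \<open>A\<close> at distance
  \<open>b * j\<close>. A pair of points arises at most as often as its distance has representations
  as such a product, and for at least half of the \<open>(b, j)\<close> this number is at most twice
  its average bound.\<close>

lemma card_arith_prog_pairs_le:
  fixes s :: "nat \<Rightarrow> int" and A :: "int set"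
  assumes B: "finite B" "0 \<notin> B" and A: "finite A"
    and sub: "\<And>b. b \<in> B \<Longrightarrow> arith_prog (s b) (int b) l \<subseteq> A" and "M \<le> l"
  shows "(real (card B) * real M)\<^sup>2 * (real l - real M)
    \<le> 4 * real (card (mult_quadruples B M)) * (real (card A))\<^sup>2"
proof (cases "B = {} \<or> M = 0")
  case False
  define P where "P = B \<times> {1..M}"
  define R where "R z = {w \<in> P. fst w * snd w = fst z * snd z}" for z
  define X where "X = real (card (mult_quadruples B M))"
  define Y where "Y = real (card P)"
  \<comment> \<open>The sum of \<open>card (R z)\<close> over \<open>P\<close> is at most
    \<open>X\<close>, so \<open>T\<close> is twice the bound \<open>X / Y\<close> for the average,
    and Markov's inequality applies.\<close>
  define T where "T = 2 * X / Y"
  have P: "finite P" and R: "finite (R z)" for z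
    using B by (auto simp: P_def R_def)
  have Y: "Y = real (card B) * real M" "0 < Y"
    using False B by (auto simp: Y_def P_def card_cartesian_product card_gt_0_iff)
  obtain b where "b \<in> B" using False by blast
  then have "(b, b, 1, 1) \<in> mult_quadruples B M" using False by (auto simp: mult_quadruples_def)
  then have X: "0 < X" using B by (auto simp: X_def card_gt_0_iff)
  then have T: "0 < T" using Y by (simp add: T_def)
  define good where "good = {z \<in> P. real (card (R z)) \<le> T}"
  have "Y \<le> 2 * real (card good)"
  proof -
    have "T * real (card (P - good)) = (\<Sum>z\<in>P - good. T)" by simp
    also have "\<dots> \<le> (\<Sum>z\<in>P - good. real (card (R z)))"
      by (intro sum_mono) (auto simp: good_def)
    also have "\<dots> \<le> (\<Sum>z\<in>P. real (card (R z)))"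
      using P by (intro sum_mono2) auto
    also have "\<dots> = real (card (Sigma P R))"
      using P R by simp
    also have "\<dots> \<le> X"
    proof -
      let ?f = "\<lambda>((b, p), (b', q)). (b, b', p, q)"
      have "inj_on ?f (Sigma P R)" by (auto simp: inj_on_def)
      moreover have "?f ` Sigma P R \<subseteq> mult_quadruples B M" by (auto simp: P_def R_def mult_quadruples_def)
      ultimately show ?thesis using card_inj_on_le[of ?f "Sigma P R" "mult_quadruples B M"] B
        by (simp add: X_def)
    qed
    finally have "2 * real (card (P - good)) \<le> Y"
      using X Y by (simp add: T_def field_simps)
    moreover have "Y = real (card good) + real (card (P - good))"
      using P by (simp add: Y_def card_Diff_subset good_def card_mono)
    ultimately show ?thesis by linarith
  qed
  \<comment> \<open>For \<open>k < l - M\<close> and \<open>j \<le> M\<close>, the index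
    \<open>k + j\<close> stays below \<open>l\<close>.\<close>
  define Q where "Q = good \<times> {..<l - M}"
  define f where "f = (\<lambda>((b, j), k). (s b + int k * int b, s b + int (k + j) * int b))"
  have Q: "finite Q" using P by (simp add: Q_def good_def)
  have "f ` Q \<subseteq> A \<times> A"
  proof
    fix y assume "y \<in> f ` Q"
    then obtain b j k where y: "y = f ((b, j), k)" and "b \<in> B" "j \<le> M" "k < l - M"
      by (auto simp: Q_def good_def P_def)
    then have "s b + int k * int b \<in> A" "s b + int (k + j) * int b \<in> A"
      using sub[OF \<open>b \<in> B\<close>] by (auto simp: arith_prog_conv_image image_subset_iff simp del: of_nat_add)
    then show "y \<in> A \<times> A" by (simp add: y f_def)
  qed
  then have "real (card (f ` Q)) \<le> (real (card A))\<^sup>2"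
    using A card_mono[of "A \<times> A" "f ` Q"]
    by (simp add: card_cartesian_product power2_eq_square flip: of_nat_mult)
  \<comment> \<open>The distance of the two points fixes the product \<open>b * j\<close>; given
    \<open>(b, j)\<close>, the first point fixes \<open>k\<close>.\<close>
  have fiber: "real (card {x \<in> Q. f x = y}) \<le> T" if y: "y \<in> f ` Q" for y
  proof -
    obtain z k where zk: "(z, k) \<in> Q" "y = f (z, k)" using y by fast
    have prod_eq: "fst w * snd w = fst z * snd z" if "f (w, k') = y" for w k'
    proof -
      obtain b j where w: "w = (b, j)" by fastforce
      obtain c i where z: "z = (c, i)" by fastforce
      have "int b * int j = int c * int i"
        using that zk(2) by (auto simp: w z f_def algebra_simps)
      then show ?thesis by (simp add: w z flip: of_nat_mult)
    qed
    have snd_eq: "k' = k''" if "f (w, k') = y" "f (w, k'') = y" "(w, k') \<in> Q" for w k' k''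
    proof -
      obtain b j where w: "w = (b, j)" by fastforce
      have "b \<in> B" using that(3) by (auto simp: w Q_def good_def P_def)
      then have "b \<noteq> 0" using B(2) by metis
      then show ?thesis using that(1,2) by (auto simp: w f_def)
    qed
    have "inj_on fst {x \<in> Q. f x = y}"
      using snd_eq by (auto simp: inj_on_def)
    moreover have "fst ` {x \<in> Q. f x = y} \<subseteq> R z"
      using prod_eq by (auto simp: R_def Q_def good_def)
    ultimately have "card {x \<in> Q. f x = y} \<le> card (R z)"
      using R by (rule card_inj_on_le)
    moreover have "real (card (R z)) \<le> T" using zk(1) by (auto simp: Q_def good_def)
    ultimately show ?thesis by linarith
  qed
  have "Y * (real l - real M) / 2 \<le> real (card good) * (real l - real M)"
    using \<open>Y \<le> 2 * real (card good)\<close> \<open>M \<le> l\<close> mult_right_mono[of Y "2 * real (card good)" "real l - real M"]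
    by simp
  also have "\<dots> = real (card Q)"
    using \<open>M \<le> l\<close> by (simp add: Q_def card_cartesian_product of_nat_diff)
  also have "\<dots> = (\<Sum>y\<in>f ` Q. real (card {x \<in> Q. f x = y}))"
    using sum.image_gen[OF Q, of "\<lambda>_. 1::real" f] by simp
  also have "\<dots> \<le> real (card (f ` Q)) * T"
    using fiber by (rule sum_bounded_above)
  also have "\<dots> \<le> (real (card A))\<^sup>2 * T"
    using T \<open>real (card (f ` Q)) \<le> (real (card A))\<^sup>2\<close> by (intro mult_right_mono) auto
  finally have "Y * (Y * (real l - real M) / 2) \<le> Y * ((real (card A))\<^sup>2 * T)"
    using Y(2) by (intro mult_left_mono) auto
  also have "Y * ((real (card A))\<^sup>2 * T) = 2 * X * (real (card A))\<^sup>2"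
    using Y(2) by (simp add: T_def)
  finally have "Y\<^sup>2 * (real l - real M) \<le> 4 * X * (real (card A))\<^sup>2"
    by (simp add: power2_eq_square)
  then show ?thesis by (simp only: Y(1) X_def)
qed auto

section \<open>Positive differences and lower bounds for \<open>u\<close>\<close>

text \<open>The differences are replaced by their absolute values, each of which comes from at most
  two of them; hence at least half survive. Progressions with negative difference are
  reversed.\<close>

lemma obtain_positive_differences:
  fixes a b :: "nat \<Rightarrow> int"
  assumes "inj_on b {..<n}" "\<And>i. i < n \<Longrightarrow> b i \<noteq> 0"
  obtains B :: "nat set" and s :: "nat \<Rightarrow> int"
  where "finite B" "0 \<notin> B" "card B \<le> n" "n \<le> 2 * card B"
    "\<And>d. d \<in> B \<Longrightarrow> arith_prog (s d) (int d) l \<subseteq> (\<Union>i<n. arith_prog (a i) (b i) l)"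
proof -
  define B where "B = (\<lambda>i. nat \<bar>b i\<bar>) ` {..<n}"
  have "b ` {..<n} \<subseteq> int ` B \<union> (\<lambda>d. - int d) ` B"
  proof
    fix x assume "x \<in> b ` {..<n}"
    then have "nat \<bar>x\<bar> \<in> B" by (auto simp: B_def)
    moreover have "x = int (nat \<bar>x\<bar>) \<or> x = - int (nat \<bar>x\<bar>)" by auto
    ultimately show "x \<in> int ` B \<union> (\<lambda>d. - int d) ` B" by blast
  qed
  then have "card (b ` {..<n}) \<le> card (int ` B \<union> (\<lambda>d. - int d) ` B)"
    by (intro card_mono) (auto simp: B_def)
  also have "\<dots> \<le> card (int ` B) + card ((\<lambda>d. - int d) ` B)"
    by (rule card_Un_le)
  also have "\<dots> \<le> card B + card B"
    by (intro add_mono card_image_le) (auto simp: B_def)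
  finally have n: "n \<le> 2 * card B" using assms(1) by (simp add: card_image)
  have "\<exists>s. arith_prog s (int d) l \<subseteq> (\<Union>i<n. arith_prog (a i) (b i) l)" if d: "d \<in> B" for d
  proof -
    obtain i where i: "i < n" "int d = \<bar>b i\<bar>" using d by (auto simp: B_def)
    have "\<exists>s. arith_prog s (int d) l \<subseteq> arith_prog (a i) (b i) l"
    proof (cases "0 < b i")
      case True
      then show ?thesis using i(2) by auto
    next
      case False
      then have "int d = - b i" using i(2) by simp
      then show ?thesis using arith_prog_uminus_subset by metis
    qed
    then show ?thesis using i(1) by blast
  qed
  then obtain s where "\<And>d. d \<in> B \<Longrightarrow> arith_prog (s d) (int d) l \<subseteq> (\<Union>i<n. arith_prog (a i) (b i) l)"
    by metis
  moreover have "finite B" "0 \<notin> B" "card B \<le> n"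
    using assms(2) card_image_le[of "{..<n}" "\<lambda>i. nat \<bar>b i\<bar>"] by (auto simp: B_def)
  ultimately show thesis using that n by blast
qed

lemma u_obtain_positive_differences:
  obtains B :: "nat set" and s :: "nat \<Rightarrow> int" and A :: "int set"
  where "finite B" "0 \<notin> B" "card B \<le> n" "n \<le> 2 * card B"
    "finite A" "card A = u l n" "\<And>d. d \<in> B \<Longrightarrow> arith_prog (s d) (int d) l \<subseteq> A"
proof -
  obtain a b :: "nat \<Rightarrow> int" where ab: "inj_on b {..<n}" "\<forall>i<n. b i \<noteq> 0"
    "u l n = card (\<Union>i<n. arith_prog (a i) (b i) l)"
    using u_attained[of l n] unfolding ap_union_sizes_def by auto
  have fin: "finite (\<Union>i<n. arith_prog (a i) (b i) l)" by (simp add: arith_prog_conv_image)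
  show thesis
    by (rule obtain_positive_differences[where a = a and l = l, OF ab(1)])
      (use ab(2) in simp, rule that[OF _ _ _ _ fin ab(3)[symmetric]])
qed

text \<open>Cauchy-Schwarz over the points combines the intersection bound \<open>1 + l / h\<close>
  with the sum of inverse heights. The factor 4 pays for keeping only \<open>n / 2\<close>
  differences. The ranges of larger \<open>l\<close> differ in which summant on the right
  dominates.\<close>

lemma u_lower_bound_long:
  fixes \<epsilon> :: real
  assumes "0 < \<epsilon>"
  shows "\<exists>C\<ge>1. \<forall>n l. 0 < n \<longrightarrow>
    real n * (real l)\<^sup>2 \<le> 4 * real (u l n) * (real n + C * real l * real n powr \<epsilon>)"
proof -
  obtain C where C: "1 \<le> C" and height: "\<And>B. finite B \<Longrightarrow> 0 \<notin> B \<Longrightarrow>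
    (\<Sum>(b, b')\<in>B \<times> B. 1 / real (height b b')) \<le> C * real (card B) powr (1 + \<epsilon>)"
    using sum_inverse_height_le[OF assms] by blast
  have "real n * (real l)\<^sup>2 \<le> 4 * real (u l n) * (real n + C * real l * real n powr \<epsilon>)"
    if n: "0 < n" for n l :: nat
  proof -
    obtain B s A where B: "finite B" "0 \<notin> B" "card B \<le> n" "n \<le> 2 * card B"
      and A: "finite A" "card A = u l n" "\<And>d. d \<in> B \<Longrightarrow> arith_prog (s d) (int d) l \<subseteq> A"
      by (rule u_obtain_positive_differences[of n l]) blast
    define S where "S d = arith_prog (s d) (int d) l" for d
    have pos: "0 < d" if "d \<in> B" for d using that B(2) by (metis neq0_conv)
    have S: "finite (S d)" for d by (simp add: S_def arith_prog_conv_image)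
    have "(\<Sum>d\<in>B. real (card (S d))) = (\<Sum>d\<in>B. real l)"
      using pos by (intro sum.cong) (auto simp: S_def card_arith_prog)
    then have "(real (card B) * real l)\<^sup>2 = (\<Sum>d\<in>B. real (card (S d)))\<^sup>2" by simp
    also have "\<dots> \<le> real (card (\<Union>d\<in>B. S d)) * (\<Sum>(b, b')\<in>B \<times> B. real (card (S b \<inter> S b')))"
      using B(1) S by (rule sum_card_power2_le)
    also have "\<dots> \<le> real (u l n) * (real n * (real n + C * real l * real n powr \<epsilon>))"
    proof (intro mult_mono)
      have "(\<Union>d\<in>B. S d) \<subseteq> A" using A(3) by (auto simp: S_def)
      then show "real (card (\<Union>d\<in>B. S d)) \<le> real (u l n)"
        using A by (metis card_mono of_nat_le_iff)
      have "(\<Sum>(b, b')\<in>B \<times> B. real (card (S b \<inter> S b')))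
          \<le> (\<Sum>(b, b')\<in>B \<times> B. 1 + real l * (1 / real (height b b')))"
        using pos card_inter_arith_prog_le by (intro sum_mono) (auto simp: S_def)
      also have "\<dots> = (real (card B))\<^sup>2 + real l * (\<Sum>(b, b')\<in>B \<times> B. 1 / real (height b b'))"
        by (simp add: case_prod_unfold sum.distrib sum_distrib_left card_cartesian_product power2_eq_square)
      also have "\<dots> \<le> (real n)\<^sup>2 + real l * (C * real n powr (1 + \<epsilon>))"
      proof (intro add_mono mult_left_mono power_mono)
        have "C * real (card B) powr (1 + \<epsilon>) \<le> C * real n powr (1 + \<epsilon>)"
          using B(3) C assms by (intro mult_left_mono powr_mono2) auto
        then show "(\<Sum>(b, b')\<in>B \<times> B. 1 / real (height b b')) \<le> C * real n powr (1 + \<epsilon>)"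
          using height[OF B(1,2)] by linarith
      qed (use B(3) in auto)
      also have "\<dots> = real n * (real n + C * real l * real n powr \<epsilon>)"
        using n by (simp add: powr_add power2_eq_square algebra_simps)
      finally show "(\<Sum>(b, b')\<in>B \<times> B. real (card (S b \<inter> S b')))
          \<le> real n * (real n + C * real l * real n powr \<epsilon>)" .
    qed (auto intro!: sum_nonneg)
    finally have *: "(real (card B) * real l)\<^sup>2 \<le> real (u l n) * (real n * (real n + C * real l * real n powr \<epsilon>))" .
    have "(real n * real l)\<^sup>2 \<le> (2 * real (card B) * real l)\<^sup>2"
      using B(4) by (intro power_mono mult_right_mono) auto
    also have "\<dots> = 4 * (real (card B) * real l)\<^sup>2"
      by (simp add: power_mult_distrib)
    also have "\<dots> \<le> 4 * (real (u l n) * (real n * (real n + C * real l * real n powr \<epsilon>)))"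
      by (intro mult_left_mono *) simp
    finally have "real n * (real n * (real l)\<^sup>2)
        \<le> real n * (4 * real (u l n) * (real n + C * real l * real n powr \<epsilon>))"
      by (simp only: power2_eq_square mult_ac)
    then show ?thesis using n by simp
  qed
  then show ?thesis using C by blast
qed

text \<open>The count of pairs of points, with \<open>M\<close> about \<open>l / 2\<close> and the
  energy bound inserted. Since \<open>l \<le> n\<close>, the losses in \<open>card B\<close> and in
  \<open>M\<close> are each at most \<open>n powr \<epsilon>\<close>.\<close>

lemma u_lower_bound_short:
  fixes \<epsilon> :: real
  assumes "0 < \<epsilon>"
  shows "\<exists>C\<ge>1. \<forall>n l. 1 < l \<longrightarrow> l \<le> n \<longrightarrow>
    real n * (real l)\<^sup>2 \<le> C * real n powr (2 * \<epsilon>) * (real (u l n))\<^sup>2"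
proof -
  obtain C where C: "1 \<le> C" and cross: "\<And>B M. finite B \<Longrightarrow> 0 \<notin> B \<Longrightarrow>
    real (card (mult_quadruples B M)) \<le> C * real (card B) powr (1 + \<epsilon>) * real M powr (1 + \<epsilon>)"
    using card_mult_quadruples_le[OF assms] by blast
  have "real n * (real l)\<^sup>2 \<le> 48 * C * real n powr (2 * \<epsilon>) * (real (u l n))\<^sup>2"
    if l: "1 < l" "l \<le> n" for n l
  proof -
    obtain B s A where B: "finite B" "0 \<notin> B" "card B \<le> n" "n \<le> 2 * card B"
      and A: "finite A" "card A = u l n" "\<And>d. d \<in> B \<Longrightarrow> arith_prog (s d) (int d) l \<subseteq> A"
      by (rule u_obtain_positive_differences[of n l]) blast
    \<comment> \<open>As \<open>l \<ge> 2\<close>, \<open>M\<close> is positive; the worst case of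
      \<open>l \<le> 3 * M\<close> is \<open>l = 3\<close>.\<close>
    define M where "M = l div 2"
    have M: "0 < M" "M \<le> n" "l \<le> 3 * M" "2 * M \<le> l"
      using l by (auto simp: M_def)
    define Y where "Y = real (card B) * real M"
    have N: "0 < card B" using B(4) l by simp
    then have Y: "0 < Y" using M(1) by (simp add: Y_def)
    have "Y * (Y * (real l - real M)) \<le> 4 * real (card (mult_quadruples B M)) * (real (u l n))\<^sup>2"
      using card_arith_prog_pairs_le[OF B(1,2) A(1,3), of M] M(4) A(2)
      by (simp add: Y_def power2_eq_square mult_ac)
    also have "\<dots> \<le> 4 * (C * (Y * real n powr (2 * \<epsilon>))) * (real (u l n))\<^sup>2"
    proof (intro mult_right_mono mult_left_mono)
      have "real (card (mult_quadruples B M)) \<le> C * (Y * (real (card B) powr \<epsilon> * real M powr \<epsilon>))"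
        using cross[OF B(1,2), of M] N M(1) by (simp add: Y_def powr_add mult_ac)
      also have "\<dots> \<le> C * (Y * (real n powr \<epsilon> * real n powr \<epsilon>))"
        using B(3) M(2) C Y assms by (intro mult_left_mono mult_mono powr_mono2) auto
      finally show "real (card (mult_quadruples B M)) \<le> C * (Y * real n powr (2 * \<epsilon>))"
        by (simp flip: powr_add)
    qed auto
    finally have "Y * (Y * (real l - real M)) \<le> Y * (4 * C * real n powr (2 * \<epsilon>) * (real (u l n))\<^sup>2)"
      by (simp add: mult_ac)
    then have "Y * (real l - real M) \<le> 4 * C * real n powr (2 * \<epsilon>) * (real (u l n))\<^sup>2"
      using Y by simp
    \<comment> \<open>The losses 2, 3 and 2 here and the factor 4 above multiply to 48.\<close>
    moreover have "(real n / 2 * (real l / 3)) * (real l / 2) \<le> Y * (real l - real M)"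
      unfolding Y_def using M B(4) by (intro mult_mono) auto
    ultimately have "(real n / 2 * (real l / 3)) * (real l / 2)
        \<le> 4 * C * real n powr (2 * \<epsilon>) * (real (u l n))\<^sup>2"
      by linarith
    then show ?thesis by (simp add: power2_eq_square)
  qed
  then show ?thesis using C by (intro exI[of _ "48 * C"]) auto
qed

section \<open>Combination of the three ranges of \<open>l\<close>\<close>

theorem theorem1:
  "\<forall>\<epsilon>::real. \<epsilon> > 0 \<longrightarrow>
     (\<exists>c\<^sub>1::real. c\<^sub>1 > 0 \<and>
       (\<forall>(n::nat) (l::nat). n > 1 \<longrightarrow> l > 1 \<longrightarrow>
          (real l \<le> real n powr (1/2 - \<epsilon>) \<longrightarrow>
             real (u l n) \<ge> c\<^sub>1 * real n powr (1/2 - \<epsilon>) * real l) \<and>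
          (real n powr (1/2 - \<epsilon>) \<le> real l \<and> real l \<le> real n powr (1 - \<epsilon>) \<longrightarrow>
             real (u l n) \<ge> c\<^sub>1 * (real l)\<^sup>2) \<and>
          (real n powr (1 - \<epsilon>) \<le> real l \<longrightarrow>
             real (u l n) \<ge> c\<^sub>1 * real n powr (1 - \<epsilon>) * real l)))"
proof (intro allI impI)
  fix \<epsilon> :: real assume \<epsilon>: "0 < \<epsilon>"
  obtain C where C: "1 \<le> C" and long: "\<And>n l. 0 < n \<Longrightarrow>
    real n * (real l)\<^sup>2 \<le> 4 * real (u l n) * (real n + C * real l * real n powr \<epsilon>)"
    using u_lower_bound_long[OF \<epsilon>] by blast
  obtain D where D: "1 \<le> D" and short: "\<And>n l. 1 < l \<Longrightarrow> l \<le> n \<Longrightarrow>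
    real n * (real l)\<^sup>2 \<le> D * real n powr (2 * \<epsilon>) * (real (u l n))\<^sup>2"
    using u_lower_bound_short[OF \<epsilon>] by blast
  \<comment> \<open>One constant for all ranges; the first needs \<open>D \<le> K\<^sup>2\<close>,
    which holds because \<open>D \<le> K\<close> and \<open>K \<ge> 1\<close>.\<close>
  define K where "K = D + 4 * (1 + C)"
  have K: "0 < K" "1 \<le> K" "D \<le> K" "4 * (1 + C) \<le> K" using C D by (auto simp: K_def)
  have "1 / K * real n powr (1/2 - \<epsilon>) * real l \<le> real (u l n)"
    if n: "1 < n" and l: "1 < l" "real l \<le> real n powr (1/2 - \<epsilon>)" for n l
  proof -
    have "real n powr (1/2 - \<epsilon>) \<le> real n powr 1"
      using n \<epsilon> by (intro powr_mono) auto
    then have "l \<le> n" using l n by simp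
    \<comment> \<open>The loss \<open>n powr (2 * \<epsilon>)\<close> sits beside the square of
      \<open>u l n\<close>, so it costs only \<open>n powr \<epsilon>\<close> in the end.\<close>
    have "(real n powr (1/2 - \<epsilon>) * real l)\<^sup>2 * real n powr (2 * \<epsilon>) = real n * (real l)\<^sup>2"
    proof -
      have "(real n powr (1/2 - \<epsilon>))\<^sup>2 * real n powr (2 * \<epsilon>) = real n"
        using n by (simp add: power2_eq_square flip: powr_add)
      then show ?thesis by (simp add: power_mult_distrib mult_ac)
    qed
    also have "\<dots> \<le> D * (real (u l n))\<^sup>2 * real n powr (2 * \<epsilon>)"
      using short[OF l(1) \<open>l \<le> n\<close>] by (simp add: mult_ac)
    finally have "(real n powr (1/2 - \<epsilon>) * real l)\<^sup>2 \<le> D * (real (u l n))\<^sup>2"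
      using n by simp
    also have "\<dots> \<le> K\<^sup>2 * (real (u l n))\<^sup>2"
      using K(2,3) self_le_power[of K 2] by (intro mult_right_mono) auto
    finally have "(real n powr (1/2 - \<epsilon>) * real l)\<^sup>2 \<le> (K * real (u l n))\<^sup>2"
      by (simp add: power_mult_distrib)
    then have "real n powr (1/2 - \<epsilon>) * real l \<le> K * real (u l n)"
      by (rule power2_le_imp_le) (use K in simp)
    then show ?thesis using K(1) by (simp add: field_simps)
  qed
  moreover have "1 / K * (real l)\<^sup>2 \<le> real (u l n)"
    if n: "1 < n" and l: "real l \<le> real n powr (1 - \<epsilon>)" for n l
  proof -
    \<comment> \<open>In this range \<open>l * n powr \<epsilon> \<le> n\<close>, so the summand
      \<open>n\<close> dominates in \<open>long\<close>.\<close>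
    have "real l * real n powr \<epsilon> \<le> real n powr (1 - \<epsilon>) * real n powr \<epsilon>"
      using l by (intro mult_right_mono) auto
    also have "\<dots> = real n" using n by (simp flip: powr_add)
    finally have "C * (real l * real n powr \<epsilon>) \<le> C * real n"
      using C by (intro mult_left_mono) auto
    then have "4 * real (u l n) * (real n + C * real l * real n powr \<epsilon>) \<le> 4 * real (u l n) * (real n + C * real n)"
      by (intro mult_left_mono) (auto simp: mult_ac)
    with long[of n l] n have "real n * (real l)\<^sup>2 \<le> real n * (4 * (1 + C) * real (u l n))"
      by (simp add: algebra_simps)
    then have "(real l)\<^sup>2 \<le> 4 * (1 + C) * real (u l n)" using n by simp
    also have "\<dots> \<le> K * real (u l n)" using K(4) by (intro mult_right_mono) auto
    finally show ?thesis using K(1) by (simp add: field_simps)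
  qed
  moreover have "1 / K * real n powr (1 - \<epsilon>) * real l \<le> real (u l n)"
    if n: "1 < n" and l: "1 < l" "real n powr (1 - \<epsilon>) \<le> real l" for n l
  proof -
    \<comment> \<open>In this range \<open>n \<le> l * n powr \<epsilon>\<close>, so the other
      summand dominates.\<close>
    have n': "real n = real n powr (1 - \<epsilon>) * real n powr \<epsilon>"
      using n by (simp flip: powr_add)
    also have "\<dots> \<le> real l * real n powr \<epsilon>"
      using l(2) by (intro mult_right_mono) auto
    finally have "4 * real (u l n) * (real n + C * real l * real n powr \<epsilon>)
        \<le> 4 * real (u l n) * (real l * real n powr \<epsilon> + C * real l * real n powr \<epsilon>)"
      using C by (intro mult_left_mono add_mono) auto
    with long[of n l] n have "real n * (real l)\<^sup>2
        \<le> (real l * real n powr \<epsilon>) * (4 * (1 + C) * real (u l n))"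
      by (simp add: algebra_simps)
    moreover have "real n * (real l)\<^sup>2 = (real l * real n powr \<epsilon>) * (real n powr (1 - \<epsilon>) * real l)"
      by (subst n') (simp add: power2_eq_square mult_ac)
    ultimately have "real n powr (1 - \<epsilon>) * real l \<le> 4 * (1 + C) * real (u l n)"
      using n l(1) by simp
    also have "\<dots> \<le> K * real (u l n)" using K(4) by (intro mult_right_mono) auto
    finally show ?thesis using K(1) by (simp add: field_simps)
  qed
  ultimately show "\<exists>c\<^sub>1::real. c\<^sub>1 > 0 \<and>
       (\<forall>(n::nat) (l::nat). n > 1 \<longrightarrow> l > 1 \<longrightarrow>
          (real l \<le> real n powr (1/2 - \<epsilon>) \<longrightarrow>
             real (u l n) \<ge> c\<^sub>1 * real n powr (1/2 - \<epsilon>) * real l) \<and>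
          (real n powr (1/2 - \<epsilon>) \<le> real l \<and> real l \<le> real n powr (1 - \<epsilon>) \<longrightarrow>
             real (u l n) \<ge> c\<^sub>1 * (real l)\<^sup>2) \<and>
          (real n powr (1 - \<epsilon>) \<le> real l \<longrightarrow>
             real (u l n) \<ge> c\<^sub>1 * real n powr (1 - \<epsilon>) * real l))"
    using K(1) by (intro exI[of _ "1 / K"] conjI allI impI) auto
qed

end
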